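(* Let $k\ge 3$, let $G$ be a minimal $(k,g)$-cage, and let $d=\lfloor g/2\rfloor$. Then the distance spectral radius $\lambda_1$ of $G$ is $$\lambda_1=\begin{cases}\dfrac{k\{1-(k-1)^{d}\}}{(2-k)^{2}}-\dfrac{2d(k-1)^{d}}{2-k}, & g \text{ even},\\[2mm] \dfrac{k\{1-(k-1)^{d}\}}{(2-k)^{2}}-\dfrac{dk(k-1)^{d}}{2-k}, & g\text{ odd}.\end{cases}$$
   Context: All graphs are finite, simple, connected and undirected. The distance matrix $D(G)$ of a graph $G$ on vertices $v_1,\dots,v_n$ is the $n\times n$ matrix whose $(i,j)$ entry is the graph distance between $v_i$ and $v_j$. The distance spectral radius of $G$ is the largest eigenvalue of $D(G)$. A $(k,g)$-cage is a $k$-regular simple graph of girth $g$ with the minimum possible number of vertices $n(k,g)$. With $d=\lfloor g/2\rfloor$, one has the lower bound $n(k,g)\ge n_0(k,g)$, where $n_0(k,g)=1+\sum_{i=0}^{d-1}k(k-1)^i$ if $g$ is odd, and $n_0(k,g)=1+\sum_{i=0}^{d-2}k(k-1)^i+(k-1)^{d-1}$ if $g$ is even. A minimal $(k,g)$-cage (Moore graph) is a $(k,g)$-cage with exactly $n_0(k,g)$ vertices; its diameter is $d$. *)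

theory Defs
  imports
    "Graph_Theory.Graph_Theory"
    "Jordan_Normal_Form.Spectral_Radius"
    "HOL-Library.Extended_Nat"
begin

text \<open>
  A finite simple undirected graph is a \<^locale>\<open>pair_graph\<close>: a finite loop-free digraph without
  parallel arcs whose arc relation is symmetric, so each edge is a pair of opposite arcs.
\<close>

definition connected_graph :: "'a pair_pre_digraph \<Rightarrow> bool" where
  "connected_graph G \<longleftrightarrow> pair_graph G \<and> Digraph_Component.connected (with_proj G)"

definition regular_graph :: "nat \<Rightarrow> 'a pair_pre_digraph \<Rightarrow> bool" where
  "regular_graph k G \<longleftrightarrow> (\<forall>v \<in> pverts G. out_degree (with_proj G) v = k)"

text \<open>
  Going back and forth along an edge is a directed cycle of length 2; the condition on the
  length excludes exactly these. The girth of an acyclic graph is \<open>\<infinity>\<close>.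
\<close>

definition girth :: "'a pair_pre_digraph \<Rightarrow> enat" where
  "girth G = (INF c \<in> {c. pre_digraph.cycle (with_proj G) c \<and> 3 \<le> length c}. enat (length c))"

definition regular_of_girth :: "nat \<Rightarrow> nat \<Rightarrow> 'a pair_pre_digraph \<Rightarrow> bool" where
  "regular_of_girth k g G \<longleftrightarrow> connected_graph G \<and> regular_graph k G \<and> girth G = enat g"

text \<open>
  Every finite graph is isomorphic to one with vertices in \<^typ>\<open>nat\<close>, so the minimum
  over \<^typ>\<open>nat\<close>-graphs is the minimum over all graphs.
\<close>

definition cage_order :: "nat \<Rightarrow> nat \<Rightarrow> nat" where
  "cage_order k g =
     (LEAST n. \<exists>H :: nat pair_pre_digraph. regular_of_girth k g H \<and> card (pverts H) = n)"

definition cage :: "nat \<Rightarrow> nat \<Rightarrow> 'a pair_pre_digraph \<Rightarrow> bool" where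
  "cage k g G \<longleftrightarrow> regular_of_girth k g G \<and> card (pverts G) = cage_order k g"

definition moore_bound :: "nat \<Rightarrow> nat \<Rightarrow> nat" where
  "moore_bound k g = (let d = g div 2 in
     if odd g then 1 + (\<Sum>i<d. k * (k - 1) ^ i)
     else 1 + (\<Sum>i<d - 1. k * (k - 1) ^ i) + (k - 1) ^ (d - 1))"

definition minimal_cage :: "nat \<Rightarrow> nat \<Rightarrow> 'a pair_pre_digraph \<Rightarrow> bool" where
  "minimal_cage k g G \<longleftrightarrow> cage k g G \<and> card (pverts G) = moore_bound k g"

definition graph_dist :: "'a pair_pre_digraph \<Rightarrow> 'a \<Rightarrow> 'a \<Rightarrow> real" where
  "graph_dist G u v = real_of_ereal (wf_digraph.\<mu> (with_proj G) (\<lambda>_. 1) u v)"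

text \<open>The list \<open>vs\<close> is the labelling \<open>v\<^sub>1, \<dots>, v\<^sub>n\<close> of the vertices.\<close>

definition distance_matrix :: "'a pair_pre_digraph \<Rightarrow> 'a list \<Rightarrow> real mat" where
  "distance_matrix G vs =
     mat (length vs) (length vs) (\<lambda>(i, j). graph_dist G (vs ! i) (vs ! j))"

text \<open>
  \<^const>\<open>spectral_radius\<close> is the largest modulus of an eigenvalue of a complex matrix; here the
  largest eigenvalue of a real (symmetric) matrix is meant.
\<close>

definition distance_spectral_radius :: "'a pair_pre_digraph \<Rightarrow> 'a list \<Rightarrow> real" where
  "distance_spectral_radius G vs = Max (spectrum (distance_matrix G vs))"

end

theory Submission
  imports Defs
begin

text \<open>
  Sort the vertices by their distance \<open>i\<close> from a fixed vertex. Two predecessors of a vertex, or an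
  arc inside a level, close up a non-backtracking walk of length \<open>2 * i + 2\<close> respectively
  \<open>2 * i + 1\<close>, and every such closed walk contains a cycle. Below the girth the levels therefore
  grow like a tree, and since the order of the graph equals the Moore bound, the lower bounds for
  the level sizes are all attained. Hence every row of the distance matrix has the same sum, and
  this sum is the largest eigenvalue because the matrix is nonnegative.
\<close>


section \<open>Connectedness, walks as vertex sequences, and cycles\<close>

locale connected_pair_graph = pair_graph +
  assumes reachable_verts: "u \<in> pverts G \<Longrightarrow> v \<in> pverts G \<Longrightarrow> u \<rightarrow>\<^sup>*\<^bsub>with_proj G\<^esub> v"

text \<open>The notion \<open>connected\<close> refers to the symmetric closure; since the arc
  relation is already symmetric, it yields directed reachability both ways.\<close>

lemma connected_graphD:
  assumes "connected_graph G"
  shows "connected_pair_graph G"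
proof -
  interpret pair_graph G using assms by (simp add: connected_graph_def)
  have "strongly_connected (with_proj G)"
    using assms pair_sym_arcs
    by (intro symmetric_connected_imp_strongly_connected) (auto simp: connected_graph_def)
  then show ?thesis
    by unfold_locales (auto simp: strongly_connected_def)
qed

context pair_graph
begin

text \<open>Walks are constructed as vertex sequences indexed by \<open>nat\<close>, so that gluing
  and reversing them is arithmetic on indices; this is the passage back to arc lists.\<close>

lemma awalk_of_fun:
  assumes "x 0 \<in> pverts G" "\<And>i. i < n \<Longrightarrow> (x i, x (Suc i)) \<in> parcs G"
  shows "awalk (x 0) (map (\<lambda>i. (x i, x (Suc i))) [0..<n]) (x n)"
  using assms
proof (induction n)
  case 0
  then show ?case by (simp add: awalk_Nil_iff)
next
  case (Suc n)
  then have "awalk (x 0) (map (\<lambda>i. (x i, x (Suc i))) [0..<n]) (x n)" by simp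
  moreover have "awalk (x n) [(x n, x (Suc n))] (x (Suc n))"
    using Suc.prems(2)[of n] by (auto simp: awalk_simps dest: wellformed')
  ultimately have "awalk (x 0) (map (\<lambda>i. (x i, x (Suc i))) [0..<n] @ [(x n, x (Suc n))]) (x (Suc n))"
    by (rule awalk_appendI)
  then show ?case by (simp del: awalk_append_iff)
qed

lemma cycle_of_fun:
  assumes "0 < n" "x n = x 0" "\<And>i. i < n \<Longrightarrow> (x i, x (Suc i)) \<in> parcs G" "inj_on x {..<n}"
  shows "cycle (map (\<lambda>i. (x i, x (Suc i))) [0..<n])" (is "cycle ?p")
  unfolding cycle_def
proof (intro exI conjI)
  have V: "x 0 \<in> pverts G" using assms(1) assms(3)[of 0] by (auto dest: wellformed')
  show w: "awalk (x 0) ?p (x 0)" using awalk_of_fun[of x n, OF V assms(3)] assms(2) by simp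
  show "?p \<noteq> []" using assms(1) by simp
  have "tl (awalk_verts (x 0) ?p) = map snd ?p"
    using w assms(1) awalk_verts_conv'[of "x 0" ?p "x 0"] by (auto simp: awalk_def)
  moreover have "inj_on (\<lambda>i. x (Suc i)) {0..<n}"
  proof (rule inj_onI)
    fix i j assume ij: "i \<in> {0..<n}" "j \<in> {0..<n}" "x (Suc i) = x (Suc j)"
    \<comment> \<open>The tail of the vertex list is \<open>x 1, ..., x n\<close>, whereas
      injectivity is known on \<open>x 0, ..., x (n - 1)\<close>. As \<open>x n = x 0\<close>, the
      index \<open>n\<close> can be replaced by 0.\<close>
    define r where "r m = (if m = n then 0 else m)" for m :: nat
    have "x (r (Suc i)) = x (r (Suc j))" using ij(3) assms(2) by (simp add: r_def) metis
    then have "r (Suc i) = r (Suc j)"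
      using ij assms(1) by (intro inj_onD[OF assms(4)]) (auto simp: r_def)
    then show "i = j" by (auto simp: r_def split: if_splits)
  qed
  ultimately show "distinct (tl (awalk_verts (x 0) ?p))"
    by (simp add: distinct_map o_def)
qed

text \<open>A shortest closed segment of a non-backtracking walk is a cycle.\<close>

lemma girth_le_closed_walk:
  assumes "0 < n" "x n = x 0" "\<And>i. i < n \<Longrightarrow> (x i, x (Suc i)) \<in> parcs G"
    and nb: "\<And>i. i + 2 \<le> n \<Longrightarrow> x i \<noteq> x (i + 2)"
  shows "girth G \<le> enat n"
proof -
  \<comment> \<open>\<open>P m\<close> says that some segment of length \<open>m\<close> is closed.
    For the least such \<open>m\<close>, loops exclude 1, backtracking excludes 2, and a repeated
    vertex inside the segment would give a shorter closed one.\<close>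
  define P where "P m \<longleftrightarrow> 0 < m \<and> (\<exists>a. a + m \<le> n \<and> x (a + m) = x a)" for m
  define m where "m = (LEAST m. P m)"
  have "P n" using assms(1,2) by (auto simp: P_def intro!: exI[of _ 0])
  then have "P m" and "m \<le> n" unfolding m_def by (rule LeastI, rule Least_le)
  have min: "m \<le> j" if "P j" for j using that unfolding m_def by (rule Least_le)
  obtain a where a: "0 < m" "a + m \<le> n" "x (a + m) = x a" using \<open>P m\<close> by (auto simp: P_def)
  have "m \<noteq> 1" using a assms(3)[of a] no_loops'[of "x a" "x a"] by auto
  moreover have "m \<noteq> 2" using a nb[of a] by auto
  ultimately have "3 \<le> m" using a by linarith
  define y where "y i = x (a + i)" for i
  have ne: "y i \<noteq> y j" if "i < j" "j < m" for i j
  proof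
    assume "y i = y j"
    then have "x ((a + i) + (j - i)) = x (a + i)" using that by (simp add: y_def)
    then have "P (j - i)" unfolding P_def using that a by (intro conjI exI[of _ "a + i"]) auto
    from min[OF this] that show False by simp
  qed
  have "cycle (map (\<lambda>i. (y i, y (Suc i))) [0..<m])" (is "cycle ?c")
  proof (rule cycle_of_fun)
    show "y m = y 0" "\<And>i. i < m \<Longrightarrow> (y i, y (Suc i)) \<in> parcs G"
      using a assms(3) by (simp_all add: y_def)
    show "inj_on y {..<m}"
      by (rule inj_onI) (metis ne lessThan_iff linorder_neqE_nat)
  qed (use a in simp)
  then have "girth G \<le> enat (length ?c)"
    unfolding girth_def using \<open>3 \<le> m\<close> by (intro INF_lower) auto
  also have "\<dots> \<le> enat n" using \<open>m \<le> n\<close> by simp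
  finally show ?thesis .
qed

end

section \<open>Distances as natural numbers, and geodesics\<close>

text \<open>The value of \<open>graph_dist\<close> comes from an infimum of extended reals; a value
  in \<open>nat\<close> permits induction on the distance and counting by levels. Connectedness
  makes the two agree.\<close>

definition hop_dist :: "'a pair_pre_digraph \<Rightarrow> 'a \<Rightarrow> 'a \<Rightarrow> nat" where
  "hop_dist G u v = (LEAST n. \<exists>p. pre_digraph.awalk (with_proj G) u p v \<and> length p = n)"

context connected_pair_graph
begin

lemma hop_dist_le: "awalk u p v \<Longrightarrow> hop_dist G u v \<le> length p"
  unfolding hop_dist_def by (rule Least_le) auto

lemma hop_dist_walk:
  assumes "u \<in> pverts G" "v \<in> pverts G"
  obtains p where "awalk u p v" "length p = hop_dist G u v"
proof -
  obtain p where "awalk u p v" using reachable_verts[OF assms] by (auto simp: reachable_awalk)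
  then have "\<exists>n p. awalk u p v \<and> length p = n" by auto
  then have "\<exists>p. awalk u p v \<and> length p = hop_dist G u v"
    unfolding hop_dist_def by (rule LeastI_ex)
  then show ?thesis using that by auto
qed

lemma graph_dist_eq_hop_dist:
  assumes "u \<in> pverts G" "v \<in> pverts G"
  shows "graph_dist G u v = real (hop_dist G u v)"
proof -
  have cost: "awalk_cost (\<lambda>_. 1) p = real (length p)" for p
    by (simp add: awalk_cost_def sum_list_triv)
  obtain p where p: "awalk u p v" "length p = hop_dist G u v" using hop_dist_walk[OF assms] .
  have "\<mu> (\<lambda>_. 1) u v = ereal (real (hop_dist G u v))"
    unfolding \<mu>_def
  proof (rule antisym)
    show "(INF p\<in>{p. awalk u p v}. ereal (awalk_cost (\<lambda>_. 1) p)) \<le> ereal (real (hop_dist G u v))"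
      using p by (intro INF_lower2[of p]) (auto simp: cost)
    show "ereal (real (hop_dist G u v)) \<le> (INF p\<in>{p. awalk u p v}. ereal (awalk_cost (\<lambda>_. 1) p))"
      by (intro INF_greatest) (auto simp: cost hop_dist_le)
  qed
  then show ?thesis by (simp add: graph_dist_def)
qed

lemma hop_dist_eq_0_iff:
  assumes "u \<in> pverts G" "v \<in> pverts G"
  shows "hop_dist G u v = 0 \<longleftrightarrow> u = v"
proof
  assume "hop_dist G u v = 0"
  then show "u = v" using hop_dist_walk[OF assms] by (metis awalk_empty_ends length_0_conv)
next
  assume "u = v"
  then show "hop_dist G u v = 0" using hop_dist_le[of u "[]" v] assms by (simp add: awalk_Nil_iff)
qed

lemma hop_dist_arc_le:
  assumes "u \<in> pverts G" "(w, v) \<in> parcs G"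
  shows "hop_dist G u v \<le> Suc (hop_dist G u w)"
proof -
  obtain p where p: "awalk u p w" "length p = hop_dist G u w"
    using hop_dist_walk[of u w] assms by (auto dest: wellformed')
  have "awalk w [(w, v)] v" using assms by (auto simp: awalk_simps dest: wellformed')
  from hop_dist_le[OF awalk_appendI[OF p(1) this]] p(2) show ?thesis by simp
qed

lemma hop_dist_predecessor:
  assumes "u \<in> pverts G" "v \<in> pverts G" "hop_dist G u v = Suc n"
  obtains w where "(w, v) \<in> parcs G" "hop_dist G u w = n"
proof -
  obtain p where p: "awalk u p v" "length p = Suc n" using hop_dist_walk[OF assms(1,2)] assms(3) by metis
  then obtain q e where q: "p = q @ [e]" by (cases p rule: rev_cases) auto
  obtain w z where e: "e = (w, z)" by (cases e)
  have "awalk u q w" "(w, v) \<in> parcs G" using p q e by (auto simp: awalk_simps)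
  moreover have "hop_dist G u w = n"
    using hop_dist_le[OF \<open>awalk u q w\<close>] hop_dist_arc_le[OF assms(1) \<open>(w, v) \<in> parcs G\<close>] p q assms(3)
    by simp
  ultimately show ?thesis using that by blast
qed

text \<open>Stepping back through predecessors builds the path. The last property, that index and
  distance coincide, is what later separates vertices of a glued walk by their level.\<close>

lemma geodesic:
  assumes "u \<in> pverts G" "v \<in> pverts G"
  obtains x where "x 0 = u" "x (hop_dist G u v) = v"
    "\<And>i. i < hop_dist G u v \<Longrightarrow> (x i, x (Suc i)) \<in> parcs G"
    "\<And>i. i \<le> hop_dist G u v \<Longrightarrow> hop_dist G u (x i) = i"
proof -
  have "\<exists>x. x 0 = u \<and> x n = v \<and> (\<forall>i<n. (x i, x (Suc i)) \<in> parcs G) \<and> (\<forall>i\<le>n. hop_dist G u (x i) = i)"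
    if "v \<in> pverts G" "hop_dist G u v = n" for n v
    using that
  proof (induction n arbitrary: v)
    case 0
    then show ?case using assms(1) hop_dist_eq_0_iff[of u v] by (intro exI[of _ "\<lambda>_. u"]) auto
  next
    case (Suc n)
    obtain w where w: "(w, v) \<in> parcs G" "hop_dist G u w = n"
      using hop_dist_predecessor[OF assms(1) Suc.prems] .
    then obtain x where x: "x 0 = u" "x n = w" "\<forall>i<n. (x i, x (Suc i)) \<in> parcs G"
      "\<forall>i\<le>n. hop_dist G u (x i) = i"
      using Suc.IH[of w] by (auto dest: wellformed')
    then show ?case using w Suc.prems
      by (intro exI[of _ "x(Suc n := v)"]) (auto simp: less_Suc_eq le_Suc_eq)
  qed
  from this[OF assms(2) refl] show ?thesis using that by blast
qed

section \<open>Short closed walks from violations of the tree structure\<close>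

text \<open>Going up a geodesic to \<open>x\<close>, over \<open>w\<close>, and down a geodesic from
  \<open>y\<close> gives levels 0, ..., \<open>i\<close>, \<open>i + 1\<close>, \<open>i\<close>,
  ..., 0. Vertices two steps apart have different levels, except around \<open>w\<close>, where
  \<open>x\<close> and \<open>y\<close> differ. The geodesics may overlap, since only backtracking
  has to be avoided.\<close>

lemma girth_le_two_predecessors:
  assumes "u \<in> pverts G" "(x, w) \<in> parcs G" "(y, w) \<in> parcs G" "x \<noteq> y"
    "hop_dist G u x = i" "hop_dist G u y = i" "hop_dist G u w = Suc i"
  shows "girth G \<le> enat (2 * i + 2)"
proof -
  have V: "x \<in> pverts G" "y \<in> pverts G" using assms by (auto dest: wellformed')
  obtain a where a: "a 0 = u" "a i = x" "\<And>j. j < i \<Longrightarrow> (a j, a (Suc j)) \<in> parcs G"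
    "\<And>j. j \<le> i \<Longrightarrow> hop_dist G u (a j) = j"
    using geodesic[OF assms(1) V(1)] assms(5) by metis
  obtain b where b: "b 0 = u" "b i = y" "\<And>j. j < i \<Longrightarrow> (b j, b (Suc j)) \<in> parcs G"
    "\<And>j. j \<le> i \<Longrightarrow> hop_dist G u (b j) = j"
    using geodesic[OF assms(1) V(2)] assms(6) by metis
  define z where "z j = (if j \<le> i then a j else if j = Suc i then w else b (2 * i + 2 - j))" for j
  have hop: "hop_dist G u (z j) = min j (2 * i + 2 - j)" if "j \<le> 2 * i + 2" for j
    using that a(4) b(4) assms(7) by (auto simp: z_def min_def)
  show ?thesis
  proof (rule girth_le_closed_walk)
    show "z (2 * i + 2) = z 0" using a b by (simp add: z_def)
  next
    fix j assume j: "j < 2 * i + 2"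
    consider "j < i" | "j = i" | "j = Suc i" | "Suc i < j" by linarith
    then show "(z j, z (Suc j)) \<in> parcs G"
    proof cases
      case 1 then show ?thesis using a(3) by (simp add: z_def)
    next
      case 2 then show ?thesis using a(2) assms(2) by (simp add: z_def)
    next
      case 3 then show ?thesis using b(2) assms(3) arcs_symmetric by (simp add: z_def)
    next
      case 4
      \<comment> \<open>On the way down the arc is \<open>(b (Suc m), b m)\<close>, the reverse of a
        geodesic arc.\<close>
      define m where "m = 2 * i + 1 - j"
      have "m < i" "2 * i + 2 - j = Suc m" "2 * i + 2 - Suc j = m" using 4 j by (auto simp: m_def)
      then show ?thesis using 4 b(3)[of m] arcs_symmetric by (simp add: z_def)
    qed
  next
    fix j assume j: "j + 2 \<le> 2 * i + 2"
    show "z j \<noteq> z (j + 2)"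
    proof (cases "j = i")
      case True then show ?thesis using assms(4) a(2) b(2) by (simp add: z_def)
    next
      case False
      then have "hop_dist G u (z j) \<noteq> hop_dist G u (z (j + 2))"
        using j hop[of j] hop[of "j + 2"] by (auto simp: min_def)
      then show ?thesis by metis
    qed
  qed simp
qed

text \<open>The same walk with the arc from \<open>x\<close> to \<open>y\<close> as its top has odd
  length.\<close>

lemma girth_le_level_arc:
  assumes "u \<in> pverts G" "(x, y) \<in> parcs G" "hop_dist G u x = i" "hop_dist G u y = i"
  shows "girth G \<le> enat (2 * i + 1)"
proof -
  have V: "x \<in> pverts G" "y \<in> pverts G" using assms by (auto dest: wellformed')
  obtain a where a: "a 0 = u" "a i = x" "\<And>j. j < i \<Longrightarrow> (a j, a (Suc j)) \<in> parcs G"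
    "\<And>j. j \<le> i \<Longrightarrow> hop_dist G u (a j) = j"
    using geodesic[OF assms(1) V(1)] assms(3) by metis
  obtain b where b: "b 0 = u" "b i = y" "\<And>j. j < i \<Longrightarrow> (b j, b (Suc j)) \<in> parcs G"
    "\<And>j. j \<le> i \<Longrightarrow> hop_dist G u (b j) = j"
    using geodesic[OF assms(1) V(2)] assms(4) by metis
  define z where "z j = (if j \<le> i then a j else b (2 * i + 1 - j))" for j
  have hop: "hop_dist G u (z j) = min j (2 * i + 1 - j)" if "j \<le> 2 * i + 1" for j
    using that a(4) b(4) by (auto simp: z_def min_def)
  show ?thesis
  proof (rule girth_le_closed_walk)
    show "z (2 * i + 1) = z 0" using a b by (simp add: z_def)
  next
    fix j assume j: "j < 2 * i + 1"
    consider "j < i" | "j = i" | "i < j" by linarith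
    then show "(z j, z (Suc j)) \<in> parcs G"
    proof cases
      case 1 then show ?thesis using a(3) by (simp add: z_def)
    next
      case 2 then show ?thesis using a(2) b(2) assms(2) by (simp add: z_def)
    next
      case 3
      define m where "m = 2 * i - j"
      have "m < i" "2 * i + 1 - j = Suc m" "2 * i + 1 - Suc j = m" using 3 j by (auto simp: m_def)
      then show ?thesis using 3 b(3)[of m] arcs_symmetric by (simp add: z_def)
    qed
  next
    fix j assume j: "j + 2 \<le> 2 * i + 1"
    \<comment> \<open>Equal levels would force \<open>2 * j + 1 = 2 * i\<close>, which parity
      excludes.\<close>
    have "hop_dist G u (z j) \<noteq> hop_dist G u (z (j + 2))"
      using j hop[of j] hop[of "j + 2"] by (auto simp: min_def) presburger+
    then show "z j \<noteq> z (j + 2)" by metis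
  qed simp
qed

section \<open>Growth from one distance level to the next\<close>

definition hop_level :: "'a \<Rightarrow> nat \<Rightarrow> 'a set" where
  "hop_level u i = {v \<in> pverts G. hop_dist G u v = i}"

definition upper_neighbours :: "'a \<Rightarrow> 'a \<Rightarrow> 'a set" where
  "upper_neighbours u x = {y. (x, y) \<in> parcs G \<and> hop_dist G u y = Suc (hop_dist G u x)}"

lemma finite_hop_level [simp, intro]: "finite (hop_level u i)"
  using pair_finite_verts by (simp add: hop_level_def)

lemma finite_neighbours: "finite {y. (x, y) \<in> parcs G}"
  by (rule finite_subset[OF _ pair_finite_verts]) (auto dest: wellformed')

lemma finite_upper_neighbours [simp, intro]: "finite (upper_neighbours u x)"
  using finite_neighbours by (rule rev_finite_subset) (auto simp: upper_neighbours_def)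

lemma upper_neighbours_subset: "x \<in> hop_level u i \<Longrightarrow> upper_neighbours u x \<subseteq> hop_level u (Suc i)"
  by (auto simp: upper_neighbours_def hop_level_def dest: wellformed')

lemma card_neighbours: "card {y. (x, y) \<in> parcs G} = out_degree (with_proj G) x"
proof -
  have "out_arcs (with_proj G) x = Pair x ` {y. (x, y) \<in> parcs G}"
    by (auto simp: out_arcs_def)
  then show ?thesis by (simp add: out_degree_def card_image inj_on_def)
qed

text \<open>Neighbours of \<open>x\<close> lie in levels \<open>i - 1\<close>, \<open>i\<close> and
  \<open>i + 1\<close>. The girth forbids any in level \<open>i\<close> and more than one in level
  \<open>i - 1\<close>; the rest are upper neighbours.\<close>

lemma card_upper_neighbours:
  assumes "u \<in> pverts G" "x \<in> hop_level u i" "enat (2 * i + 1) < girth G"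
  shows "out_degree (with_proj G) x - (if i = 0 then 0 else 1) \<le> card (upper_neighbours u x)"
proof -
  \<comment> \<open>Written with \<open>Suc\<close> instead of \<open>i - 1\<close>, so that
    \<open>L\<close> is empty for \<open>i = 0\<close>.\<close>
  define L where "L = {y. (x, y) \<in> parcs G \<and> Suc (hop_dist G u y) = i}"
  have x: "x \<in> pverts G" "hop_dist G u x = i" using assms(2) by (auto simp: hop_level_def)
  have "{y. (x, y) \<in> parcs G} \<subseteq> upper_neighbours u x \<union> L"
  proof
    fix y assume "y \<in> {y. (x, y) \<in> parcs G}"
    then have y: "(x, y) \<in> parcs G" "(y, x) \<in> parcs G" using arcs_symmetric by auto
    have "hop_dist G u y \<noteq> i"
      using girth_le_level_arc[OF assms(1) y(1) x(2)] assms(3) by (auto simp: not_le[symmetric])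
    then show "y \<in> upper_neighbours u x \<union> L"
      using hop_dist_arc_le[OF assms(1) y(1)] hop_dist_arc_le[OF assms(1) y(2)] y x
      by (auto simp: upper_neighbours_def L_def)
  qed
  moreover have L: "finite L" "card L \<le> (if i = 0 then 0 else 1)"
  proof -
    show "finite L" using finite_neighbours by (rule rev_finite_subset) (auto simp: L_def)
    show "card L \<le> (if i = 0 then 0 else 1)"
    proof (cases i)
      case 0
      then have "L = {}" by (simp add: L_def)
      then show ?thesis by simp
    next
      case (Suc j)
      have "y = z" if "y \<in> L" "z \<in> L" for y z
      proof (rule ccontr)
        assume "y \<noteq> z"
        have yz: "(y, x) \<in> parcs G" "(z, x) \<in> parcs G" "hop_dist G u y = j" "hop_dist G u z = j"
          using that Suc arcs_symmetric by (auto simp: L_def)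
        have "girth G \<le> enat (2 * j + 2)"
          by (rule girth_le_two_predecessors[OF assms(1) yz(1,2) \<open>y \<noteq> z\<close> yz(3,4)])
            (simp add: x(2) Suc)
        then have "girth G \<le> enat (2 * i + 1)" by (rule order_trans) (simp add: Suc)
        then show False using assms(3) by (simp add: not_le[symmetric])
      qed
      then show ?thesis using \<open>finite L\<close> Suc by (auto simp: card_le_Suc0_iff_eq)
    qed
  qed
  ultimately have "card {y. (x, y) \<in> parcs G} \<le> card (upper_neighbours u x \<union> L)"
    by (intro card_mono) auto
  also have "\<dots> \<le> card (upper_neighbours u x) + card L" by (rule card_Un_le)
  finally show ?thesis using L by (simp add: card_neighbours)
qed

lemma hop_level_0: "u \<in> pverts G \<Longrightarrow> hop_level u 0 = {u}"
  using hop_dist_eq_0_iff by (auto simp: hop_level_def)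

lemma upper_neighbours_disjoint:
  assumes "u \<in> pverts G" "x \<in> hop_level u i" "y \<in> hop_level u i" "x \<noteq> y" "enat (2 * i + 2) < girth G"
  shows "upper_neighbours u x \<inter> upper_neighbours u y = {}"
proof (rule ccontr)
  assume "\<not> ?thesis"
  then obtain w where "(x, w) \<in> parcs G" "(y, w) \<in> parcs G" "hop_dist G u w = Suc i"
    using assms by (auto simp: upper_neighbours_def hop_level_def)
  then have "girth G \<le> enat (2 * i + 2)"
    using assms by (intro girth_le_two_predecessors) (auto simp: hop_level_def)
  then show False using assms(5) by (simp add: not_le[symmetric])
qed

text \<open>Under this girth bound the upper neighbourhoods of distinct vertices of a level are
  disjoint, so their sizes add up inside the next level.\<close>

lemma card_hop_level_Suc_ge:
  assumes "u \<in> pverts G" "enat (2 * i + 2) < girth G"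
    and "\<And>x. x \<in> hop_level u i \<Longrightarrow> m \<le> card (upper_neighbours u x)"
  shows "card (hop_level u i) * m \<le> card (hop_level u (Suc i))"
proof -
  have "card (hop_level u i) * m \<le> (\<Sum>x\<in>hop_level u i. card (upper_neighbours u x))"
    using sum_bounded_below[of "hop_level u i" m] assms(3) by simp
  also have "\<dots> = card (\<Union>x\<in>hop_level u i. upper_neighbours u x)"
    using upper_neighbours_disjoint[OF assms(1) _ _ _ assms(2)] by (subst card_UN_disjoint) auto
  also have "\<dots> \<le> card (hop_level u (Suc i))"
    using upper_neighbours_subset by (intro card_mono) auto
  finally show ?thesis .
qed

end

section \<open>Lower bounds for the levels of a regular graph\<close>

locale regular_connected_pair_graph = connected_pair_graph +
  fixes k :: nat
  assumes regular: "v \<in> pverts G \<Longrightarrow> out_degree (with_proj G) v = k"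
begin

text \<open>The root has \<open>k\<close> upper neighbours and every later vertex at least
  \<open>k - 1\<close>, as in the \<open>k\<close>-regular tree.\<close>

lemma card_hop_level_ge:
  assumes "u \<in> pverts G" "enat (2 * i + 2) < girth G"
  shows "k * (k - 1) ^ i \<le> card (hop_level u (Suc i))"
  using assms(2)
proof (induction i)
  case 0
  then have "enat (2 * 0 + 1) < girth G" by (rule le_less_trans[rotated]) simp
  then have "k \<le> card (upper_neighbours u u)"
    using card_upper_neighbours[of u u 0] assms(1) regular by (simp add: hop_level_0)
  then show ?case using card_hop_level_Suc_ge[of u 0 k] 0 assms(1) by (simp add: hop_level_0)
next
  case (Suc i)
  have lt: "enat (2 * Suc i + 1) < girth G" "enat (2 * i + 2) < girth G"
    using Suc.prems by (auto elim!: le_less_trans[rotated])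
  have "k - 1 \<le> card (upper_neighbours u x)" if "x \<in> hop_level u (Suc i)" for x
    using card_upper_neighbours[OF assms(1) that lt(1)] that regular by (simp add: hop_level_def)
  then have "card (hop_level u (Suc i)) * (k - 1) \<le> card (hop_level u (Suc (Suc i)))"
    using card_hop_level_Suc_ge[OF assms(1) Suc.prems] by simp
  moreover have "k * (k - 1) ^ i * (k - 1) \<le> card (hop_level u (Suc i)) * (k - 1)"
    using Suc.IH[OF lt(2)] by (rule mult_right_mono) simp
  ultimately show ?case
    unfolding power_Suc2 mult.assoc[symmetric] by (rule order_trans[rotated])
qed

text \<open>
  For even girth a vertex of the last level may have several predecessors, but at most \<open>k\<close> of
  them, so double counting of the arcs into that level loses only a factor \<open>k\<close>.
\<close>

lemma card_last_hop_level_ge: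
  assumes "0 < k" "u \<in> pverts G" "enat (2 * i + 3) < girth G"
  shows "(k - 1) ^ Suc i \<le> card (hop_level u (Suc (Suc i)))"
proof -
  let ?A = "hop_level u (Suc i)" and ?B = "hop_level u (Suc (Suc i))"
  \<comment> \<open>The assumed bound \<open>2 * i + 3\<close> is just what counting upper
    neighbours at level \<open>Suc i\<close> requires; their disjointness would require
    \<open>2 * i + 4\<close>.\<close>
  have lt: "enat (2 * Suc i + 1) < girth G" "enat (2 * i + 2) < girth G"
    using assms(3) by (auto elim!: le_less_trans[rotated])
  have "k * (k - 1) ^ Suc i \<le> card ?A * (k - 1)"
    using card_hop_level_ge[OF assms(2) lt(2)] mult_right_mono[of _ _ "k - 1"] by (fastforce simp: mult_ac)
  also have "\<dots> \<le> (\<Sum>x\<in>?A. card (upper_neighbours u x))"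
  proof -
    have "k - 1 \<le> card (upper_neighbours u x)" if "x \<in> ?A" for x
      using card_upper_neighbours[OF assms(2) that lt(1)] that regular by (simp add: hop_level_def)
    then show ?thesis using sum_bounded_below[of ?A "k - 1"] by simp
  qed
  also have "\<dots> = card (SIGMA x:?A. upper_neighbours u x)" by simp
  \<comment> \<open>Swapping the pairs counts the same arcs from their upper ends, each of which has
    \<open>k\<close> neighbours in all.\<close>
  also have "\<dots> \<le> card (SIGMA y:?B. {x. (y, x) \<in> parcs G})"
  proof (rule card_inj_on_le)
    show "inj_on prod.swap (SIGMA x:?A. upper_neighbours u x)" by simp
    show "prod.swap ` (SIGMA x:?A. upper_neighbours u x) \<subseteq> (SIGMA y:?B. {x. (y, x) \<in> parcs G})"
      using upper_neighbours_subset arcs_symmetric by (fastforce simp: upper_neighbours_def)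
    show "finite (SIGMA y:?B. {x. (y, x) \<in> parcs G})"
      using finite_neighbours by (intro finite_SigmaI) auto
  qed
  also have "\<dots> = (\<Sum>y\<in>?B. card {x. (y, x) \<in> parcs G})"
    using finite_neighbours by (simp add: card_SigmaI)
  also have "\<dots> = (\<Sum>y\<in>?B. k)"
    by (intro sum.cong) (auto simp: card_neighbours regular hop_level_def)
  also have "\<dots> = k * card ?B" by simp
  finally show ?thesis using assms(1) by simp
qed

end

section \<open>Tight counting, a geometric sum, and matrices with constant row sums\<close>

text \<open>The fibres over \<open>0, ..., d\<close> are disjoint, so their sizes sum to at most
  \<open>card V\<close>. The bounds \<open>N i\<close> already sum to at least that, so every
  inequality is tight: each fibre has exactly \<open>N i\<close> elements and no value exceeds
  \<open>d\<close>.\<close>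

lemma sum_eq_if_fibres_large:
  fixes f N :: "_ \<Rightarrow> nat"
  assumes "finite V" "\<And>i. i \<le> d \<Longrightarrow> N i \<le> card {x \<in> V. f x = i}" "card V \<le> (\<Sum>i\<le>d. N i)"
  shows "(\<Sum>x\<in>V. f x) = (\<Sum>i\<le>d. i * N i)"
proof -
  let ?F = "\<lambda>i. {x \<in> V. f x = i}"
  have U: "card (\<Union>i\<le>d. ?F i) = (\<Sum>i\<le>d. card (?F i))"
    using assms(1) by (intro card_UN_disjoint) auto
  have "(\<Sum>i\<le>d. N i) \<le> (\<Sum>i\<le>d. card (?F i))" using assms(2) by (intro sum_mono) auto
  moreover have le: "card (\<Union>i\<le>d. ?F i) \<le> card V" using assms(1) by (intro card_mono) auto
  ultimately have eq: "(\<Sum>i\<le>d. N i) = (\<Sum>i\<le>d. card (?F i))" and "card (\<Union>i\<le>d. ?F i) = card V"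
    using assms(3) U by simp_all
  then have V: "(\<Union>i\<le>d. ?F i) = V" using assms(1) by (intro card_subset_eq) auto
  have N: "card (?F i) = N i" if "i \<le> d" for i
    using sum_mono_inv[OF eq] assms(2) that by simp
  have "(\<Sum>x\<in>V. f x) = (\<Sum>i\<le>d. \<Sum>x\<in>?F i. f x)"
    using V assms(1) by (subst V[symmetric], subst sum.UNION_disjoint) auto
  also have "\<dots> = (\<Sum>i\<le>d. i * N i)"
    by (intro sum.cong) (auto simp flip: N)
  finally show ?thesis .
qed

text \<open>This is the derivative of a finite geometric series in closed form.\<close>

lemma sum_linear_geometric:
  fixes q :: "'a :: field"
  assumes "q \<noteq> 1"
  shows "(\<Sum>i<d. of_nat (Suc i) * q ^ i) = (1 - q ^ d) / (1 - q)\<^sup>2 - of_nat d * q ^ d / (1 - q)"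
proof (induction d)
  case 0
  then show ?case by simp
next
  case (Suc d)
  then show ?case using assms by (simp add: divide_simps) (simp add: algebra_simps power2_eq_square)
qed

text \<open>The all-ones vector is an eigenvector for \<open>r\<close>. Any other eigenvalue is
  bounded by reading its eigenvector equation at a coordinate of largest absolute value.\<close>

lemma Max_spectrum_constant_row_sum:
  fixes A :: "real mat"
  assumes A: "A \<in> carrier_mat n n" and "0 < n"
    and nonneg: "\<And>i j. i < n \<Longrightarrow> j < n \<Longrightarrow> 0 \<le> A $$ (i, j)"
    and row: "\<And>i. i < n \<Longrightarrow> (\<Sum>j<n. A $$ (i, j)) = r"
  shows "Max (spectrum A) = r"
proof (rule Max_eqI)
  show "finite (spectrum A)" using card_finite_spectrum[OF A] by simp
next
  have "A *\<^sub>v vec n (\<lambda>_. 1) = r \<cdot>\<^sub>v vec n (\<lambda>_. 1)"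
    using A row by (auto simp: scalar_prod_def atLeast0LessThan)
  moreover have "vec n (\<lambda>_. 1) \<noteq> (0\<^sub>v n :: real vec)"
    using \<open>0 < n\<close> by (auto simp: vec_eq_iff)
  ultimately show "r \<in> spectrum A"
    using A by (auto simp: spectrum_def eigenvalue_def eigenvector_def
        intro!: exI[of _ "vec n (\<lambda>_. 1)"])
next
  fix l assume "l \<in> spectrum A"
  then obtain x where x: "x \<in> carrier_vec n" "x \<noteq> 0\<^sub>v n" "A *\<^sub>v x = l \<cdot>\<^sub>v x"
    using A by (auto simp: spectrum_def eigenvalue_def eigenvector_def)
  define m where "m = Max ((\<lambda>j. \<bar>x $ j\<bar>) ` {..<n})"
  have le: "\<bar>x $ j\<bar> \<le> m" if "j < n" for j
    unfolding m_def using that by (intro Max_ge) auto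
  have "m \<in> (\<lambda>j. \<bar>x $ j\<bar>) ` {..<n}" unfolding m_def using \<open>0 < n\<close> by (intro Max_in) auto
  then obtain i where i: "i < n" "\<bar>x $ i\<bar> = m" by auto
  obtain j where "j < n" "x $ j \<noteq> 0" using x(1,2) by (auto simp: vec_eq_iff)
  then have "0 < m" using le[of j] by simp
  have "l * x $ i = (A *\<^sub>v x) $ i" using x i by simp
  also have "\<dots> = (\<Sum>j<n. A $$ (i, j) * x $ j)"
    using A x(1) i by (simp add: scalar_prod_def atLeast0LessThan)
  finally have "\<bar>l\<bar> * m = \<bar>\<Sum>j<n. A $$ (i, j) * x $ j\<bar>" using i by (metis abs_mult)
  also have "\<dots> \<le> (\<Sum>j<n. A $$ (i, j) * m)"
    using le nonneg i by (intro order_trans[OF sum_abs] sum_mono) (auto simp: abs_mult intro!: mult_mono)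
  also have "\<dots> = r * m" using row[OF i(1)] by (simp flip: sum_distrib_right)
  finally show "l \<le> r" using \<open>0 < m\<close> by simp
qed

section \<open>Row sums of the distance matrix of a minimal cage\<close>

lemma three_le_girth: "enat 3 \<le> girth G"
  unfolding girth_def by (intro INF_greatest) auto

theorem theorem2p1:
  fixes G :: "'a pair_pre_digraph" and vs :: "'a list" and k g d :: nat
  assumes "k \<ge> 3"
    and "minimal_cage k g G"
    and "d = g div 2"
    and "distinct vs" and "set vs = pverts G"
  shows "distance_spectral_radius G vs =
    (if even g
     then real k * (1 - (real k - 1) ^ d) / (2 - real k)\<^sup>2
            - 2 * real d * (real k - 1) ^ d / (2 - real k)
     else real k * (1 - (real k - 1) ^ d) / (2 - real k)\<^sup>2
            - real d * real k * (real k - 1) ^ d / (2 - real k))"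
    (is "_ = ?r")
proof -
  have G: "connected_graph G" "regular_graph k G" "girth G = enat g"
    and card: "card (pverts G) = moore_bound k g"
    using assms(2) by (auto simp: minimal_cage_def cage_def regular_of_girth_def)
  interpret connected_pair_graph G using G(1) by (rule connected_graphD)
  interpret regular_connected_pair_graph G k
    using G(2) by unfold_locales (auto simp: regular_graph_def)
  have "3 \<le> g" using three_le_girth[of G] G(3) by simp
  then have "0 < d" using assms(3) by simp
  then obtain e where e: "d = Suc e" using gr0_implies_Suc by blast
  \<comment> \<open>\<open>q\<close> is the cast of the truncated difference \<open>k - 1\<close>;
    from \<open>k \<ge> 3\<close> it differs from 1, so the closed form of the sum applies.\<close>
  define q where "q = real k - 1"
  have q: "real (k - 1) = q" "real k = q + 1" "q \<noteq> 1" "2 - real k = 1 - q"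
    using assms(1) by (auto simp: q_def of_nat_diff)
  have row: "(\<Sum>v\<in>pverts G. real (hop_dist G u v)) = ?r" if u: "u \<in> pverts G" for u
  proof (cases "even g")
    case True
    then have g: "g = 2 * d" using assms(3) by simp
    \<comment> \<open>An even girth is at least 4, so \<open>d = e' + 2\<close>, and the last level
      \<open>d\<close> is the one reached by \<open>card_last_hop_level_ge\<close> at
      \<open>e'\<close>.\<close>
    obtain e' where e': "e = Suc e'" using \<open>3 \<le> g\<close> e g by (cases e) auto
    \<comment> \<open>These are the summands of the Moore bound, one per level; in the even case the
      last level lacks the factor \<open>k\<close>.\<close>
    define N where "N i = (if i = 0 then 1 else if i = d then (k - 1) ^ e else k * (k - 1) ^ (i - 1))" for i
    have N: "N 0 = 1" "N d = (k - 1) ^ e" "\<And>i. i < e \<Longrightarrow> N (Suc i) = k * (k - 1) ^ i"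
      using e by (auto simp: N_def)
    have S: "(\<Sum>i\<le>d. f i) = f 0 + (\<Sum>i<e. f (Suc i)) + f d" for f :: "nat \<Rightarrow> nat"
      using sum.lessThan_Suc_shift[of f e] by (simp add: e flip: lessThan_Suc_atMost)
    have "N i \<le> card {v \<in> pverts G. hop_dist G u v = i}" if "i \<le> d" for i
    proof -
      consider "i = 0" | j where "i = Suc j" "j < e" | "i = d" using \<open>i \<le> d\<close> e by (cases i) force+
      then have "N i \<le> card (hop_level u i)"
      proof cases
        case 1 then show ?thesis using u N by (simp add: hop_level_0)
      next
        case 2 then show ?thesis using card_hop_level_ge[OF u, of j] N e g G(3) by simp
      next
        case 3
        then show ?thesis
          using card_last_hop_level_ge[of u e'] assms(1) u N e e' g G(3) by simp
      qed
      then show ?thesis by (simp add: hop_level_def)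
    qed
    moreover have "card (pverts G) \<le> (\<Sum>i\<le>d. N i)"
    proof -
      have "card (pverts G) = 1 + (\<Sum>i<e. k * (k - 1) ^ i) + (k - 1) ^ e"
        using card True e by (simp add: moore_bound_def Let_def flip: assms(3))
      then show ?thesis using N by (simp add: S)
    qed
    ultimately have "(\<Sum>v\<in>pverts G. hop_dist G u v) = (\<Sum>i\<le>d. i * N i)"
      using pair_finite_verts by (intro sum_eq_if_fibres_large)
    also have "\<dots> = k * (\<Sum>i<e. Suc i * (k - 1) ^ i) + d * (k - 1) ^ e"
      using N by (simp add: S sum_distrib_left mult_ac del: mult_Suc mult_Suc_right)
    finally have "real (\<Sum>v\<in>pverts G. hop_dist G u v) = real \<dots>" by simp
    also have "\<dots> = (q + 1) * (\<Sum>i<e. of_nat (Suc i) * q ^ i) + real d * q ^ e"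
      by (simp only: of_nat_add of_nat_mult of_nat_sum of_nat_power q(1,2))
    also have "\<dots> = ?r"
      using q(3) True unfolding sum_linear_geometric[OF q(3)] q(2,4)
      by (simp add: e divide_simps) (simp add: algebra_simps power2_eq_square)
    finally show ?thesis by simp
  next
    case False
    then have g: "g = 2 * d + 1" using assms(3) by presburger
    \<comment> \<open>With girth \<open>2 * d + 1\<close> tree growth reaches level \<open>d\<close>
      itself, as \<open>2 * j + 2 \<le> 2 * d\<close> for \<open>j < d\<close>, so no level is
      exceptional.\<close>
    define N where "N i = (if i = 0 then 1 else k * (k - 1) ^ (i - 1))" for i
    have "N i \<le> card {v \<in> pverts G. hop_dist G u v = i}" if "i \<le> d" for i
    proof -
      have "N i \<le> card (hop_level u i)"
      proof (cases i)
        case 0 then show ?thesis using u by (simp add: N_def hop_level_0)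
      next
        case (Suc j) then show ?thesis
          using card_hop_level_ge[OF u, of j] \<open>i \<le> d\<close> g G(3) by (simp add: N_def)
      qed
      then show ?thesis by (simp add: hop_level_def)
    qed
    moreover have "card (pverts G) \<le> (\<Sum>i\<le>d. N i)"
      using card False assms(3) by (simp add: sum.atMost_shift N_def moore_bound_def Let_def)
    ultimately have "(\<Sum>v\<in>pverts G. hop_dist G u v) = (\<Sum>i\<le>d. i * N i)"
      using pair_finite_verts by (intro sum_eq_if_fibres_large)
    also have "\<dots> = k * (\<Sum>i<d. Suc i * (k - 1) ^ i)"
      by (simp add: sum.atMost_shift N_def sum_distrib_left mult_ac del: mult_Suc mult_Suc_right)
    finally have "real (\<Sum>v\<in>pverts G. hop_dist G u v) = real \<dots>" by simp
    also have "\<dots> = (q + 1) * (\<Sum>i<d. of_nat (Suc i) * q ^ i)"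
      by (simp only: of_nat_add of_nat_mult of_nat_sum of_nat_power q(1,2))
    also have "\<dots> = ?r"
      using q(3) False unfolding sum_linear_geometric[OF q(3)] q(2,4)
      by (simp add: divide_simps) (simp add: algebra_simps power2_eq_square)
    finally show ?thesis by simp
  qed
  let ?n = "length vs" and ?A = "distance_matrix G vs"
  have A: "?A $$ (i, j) = real (hop_dist G (vs ! i) (vs ! j))" if "i < ?n" "j < ?n" for i j
    using that assms(5) nth_mem[of _ vs] by (simp add: distance_matrix_def graph_dist_eq_hop_dist)
  have "Max (spectrum ?A) = ?r"
  proof (rule Max_spectrum_constant_row_sum)
    show "?A \<in> carrier_mat ?n ?n" by (simp add: distance_matrix_def)
    have "0 < card (pverts G)" by (simp add: card moore_bound_def Let_def)
    then show "0 < ?n" using assms(5) by (cases vs) auto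
    show "0 \<le> ?A $$ (i, j)" if "i < ?n" "j < ?n" for i j using that by (simp add: A)
    show "(\<Sum>j<?n. ?A $$ (i, j)) = ?r" if "i < ?n" for i
    proof -
      \<comment> \<open>Distinctness of \<open>vs\<close> turns the sum over column indices into a
        sum over vertices.\<close>
      have "(\<Sum>j<?n. ?A $$ (i, j)) = (\<Sum>v\<in>set vs. real (hop_dist G (vs ! i) v))"
        using that by (simp add: A sum_list_distinct_conv_sum_set[OF assms(4), symmetric]
            sum_list_sum_nth atLeast0LessThan)
      then show ?thesis using row[of "vs ! i"] that assms(5) nth_mem[OF that] by simp
    qed
  qed
  then show ?thesis by (simp add: distance_spectral_radius_def)
qed

end
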